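(* Let $E$ and $T$ be sets, let $\mathcal{H}$ be a Hilbert space, let $\phi\colon E\to\mathcal{H}$ be a map, let $\mathcal{W}$ be a reproducing kernel Hilbert space on $T$, and let $S\colon\mathcal{H}\to\mathcal{W}$ be a linear isometry (that is, $E\overset{\phi}{\to}\mathcal{H}\overset{S}{\to}\mathcal{W}$ is a transformation sequence on $T$). Let $\hat{\mathcal{H}}$ denote the integral transform of $\mathcal{H}$ induced by $\phi$. Then, for all $f\in\overline{\mathrm{span}}\,\phi(E)$ and $t\in T$, the following identity holds: $$(Sf)(t)=\langle\hat f,\overline{(S\phi)(t,\cdot)}\rangle_{\hat{\mathcal{H}}}.$$
   Context: All Hilbert spaces are complex, with inner product linear in the first variable. A reproducing kernel Hilbert space (RKHS) on a set $T$ is a Hilbert space of functions $T\to\mathbb{C}$ such that for every $t\in T$ the evaluation $f\mapsto f(t)$ is bounded. Operator range: if $A\colon\mathcal{H}\to V$ is a linear map with closed kernel from a Hilbert space to a vector space, then $\operatorname{ran}A=A(\mathcal{H})$ carries the unique Hilbert space structure with $\langle Af,Ag\rangle_{\operatorname{ran}A}=\langle f,g\rangle_{\mathcal{H}}$ for all $f,g\in(\ker A)^\perp$. Integral transform: for a map $\phi\colon E\to\mathcal{H}$ from a set to a Hilbert space, define $\hat\phi\colon\mathcal{H}\to\mathbb{C}^E$ by $(\hat\phi f)(x)=\langle f,\phi(x)\rangle_{\mathcal{H}}$, $x\in E$. Its kernel $\phi(E)^\perp$ is closed; $\hat{\mathcal{H}}=\hat\phi(\mathcal{H})$ denotes the operator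 range of $\hat\phi$ (with its Hilbert space structure), called the integral transform of $\mathcal{H}$ induced by $\phi$. One writes $\hat f=\hat\phi f$ for $f\in\mathcal{H}$. Notation: $(S\phi)(t,x)=\bigl(S(\phi(x))\bigr)(t)$ for $(t,x)\in T\times E$, and $\overline{(S\phi)(t,\cdot)}$ is the function $x\mapsto\overline{(S\phi)(t,x)}$ on $E$. $\overline{\mathrm{span}}\,\phi(E)$ is the closed linear span of $\phi(E)$ in $\mathcal{H}$. *)

theory Defs
  imports "HOL-Analysis.Analysis" "HOL-Library.Function_Algebras"
begin

section \<open>Complex Hilbert spaces with explicit carrier\<close>

text \<open>
  Spaces of functions and operator ranges carry inner products that depend on the space and not
  only on the ambient vector space, so a Hilbert space is a record. Its vectors are a subspace of
  an ambient complex vector space whose addition is that of the type \<open>'a\<close> and whose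
  scalar multiplication is \<open>cscale\<close>; nothing is assumed of \<open>cinner\<close> off the carrier.
\<close>

record 'a cspace =
  vecs :: "'a set"
  cscale :: "complex \<Rightarrow> 'a \<Rightarrow> 'a"
  cinner :: "'a \<Rightarrow> 'a \<Rightarrow> complex"

definition cnorm :: "('a, 'm) cspace_scheme \<Rightarrow> 'a \<Rightarrow> real" where
  "cnorm H f = sqrt (Re (cinner H f f))"

text \<open>The value off the carrier is irrelevant, but \<open>Metric_space\<close> requires a
  nonnegative symmetric function on the whole type.\<close>

definition cdist :: "('a::ab_group_add, 'm) cspace_scheme \<Rightarrow> 'a \<Rightarrow> 'a \<Rightarrow> real" where
  "cdist H f g = (if f \<in> vecs H \<and> g \<in> vecs H then cnorm H (f - g) else 0)"

locale complex_inner_product_space = vector_space "cscale H"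
  for H :: "('a::ab_group_add, 'm) cspace_scheme" +
  assumes subspace_vecs: "subspace (vecs H)"
    and inner_add: "\<lbrakk>f \<in> vecs H; g \<in> vecs H; h \<in> vecs H\<rbrakk>
          \<Longrightarrow> cinner H (f + g) h = cinner H f h + cinner H g h"
    and inner_scale: "\<lbrakk>f \<in> vecs H; g \<in> vecs H\<rbrakk>
          \<Longrightarrow> cinner H (cscale H c f) g = c * cinner H f g"
    and inner_cnj: "\<lbrakk>f \<in> vecs H; g \<in> vecs H\<rbrakk> \<Longrightarrow> cinner H g f = cnj (cinner H f g)"
    and inner_nonneg: "f \<in> vecs H \<Longrightarrow> 0 \<le> Re (cinner H f f)"
    and inner_eq_0: "\<lbrakk>f \<in> vecs H; cinner H f f = 0\<rbrakk> \<Longrightarrow> f = 0"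
begin

lemma closed_ops:
  "0 \<in> vecs H" "\<lbrakk>f \<in> vecs H; g \<in> vecs H\<rbrakk> \<Longrightarrow> f + g \<in> vecs H"
  "\<lbrakk>f \<in> vecs H; g \<in> vecs H\<rbrakk> \<Longrightarrow> f - g \<in> vecs H" "f \<in> vecs H \<Longrightarrow> cscale H c f \<in> vecs H"
  using subspace_vecs by (auto simp: subspace_0 subspace_add subspace_diff subspace_scale)

lemma inner_add_right:
  assumes "f \<in> vecs H" "g \<in> vecs H" "h \<in> vecs H"
  shows "cinner H f (g + h) = cinner H f g + cinner H f h"
  using assms inner_add[of g h f] inner_cnj[of f "g + h"] inner_cnj[of f g] inner_cnj[of f h]
  by (metis closed_ops(2) complex_cnj_add inner_cnj)

lemma inner_scale_right:
  assumes "f \<in> vecs H" "g \<in> vecs H"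
  shows "cinner H f (cscale H c g) = cnj c * cinner H f g"
  using assms by (metis closed_ops(4) complex_cnj_mult inner_cnj inner_scale)

lemma inner_diff:
  assumes "f \<in> vecs H" "g \<in> vecs H" "h \<in> vecs H"
  shows "cinner H (f - g) h = cinner H f h - cinner H g h"
  using inner_add[of "f - g" g h] assms closed_ops(3)[of f g] by simp

lemma Im_inner_self: "f \<in> vecs H \<Longrightarrow> Im (cinner H f f) = 0"
  using inner_cnj[of f f] by (metis complex_cnj_cancel_iff Reals_cnj_iff complex_is_Real_iff)

lemma inner_self: "f \<in> vecs H \<Longrightarrow> cinner H f f = of_real ((cnorm H f)\<^sup>2)"
  using Im_inner_self inner_nonneg by (simp add: cnorm_def complex_eq_iff)

lemma Cauchy_Schwarz:
  assumes f: "f \<in> vecs H" and g: "g \<in> vecs H"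
  shows "cmod (cinner H f g) \<le> cnorm H f * cnorm H g"
proof (cases "g = 0")
  case True
  have "cinner H f g = 0"
    using inner_scale_right[OF f g, of 0] True by simp
  then show ?thesis by (simp add: cnorm_def inner_nonneg f g)
next
  case False
  define a where "a = cinner H f g"
  define b where "b = (cnorm H g)\<^sup>2"
  have gg: "cinner H g g = of_real b" unfolding b_def by (rule inner_self[OF g])
  have b: "b > 0"
    using False inner_eq_0[OF g] gg unfolding b_def by (metis of_real_0 zero_less_power2 power_zero_numeral)
  define c where "c = - (a / of_real b)"
  have cg: "cscale H c g \<in> vecs H" using g closed_ops by blast
  have "cinner H (f + cscale H c g) (f + cscale H c g)
      = cinner H f f + cnj c * a + c * cnj a + c * cnj c * of_real b"
    using f g cg closed_ops inner_cnj[OF f g] gg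
    by (simp add: inner_add inner_add_right inner_scale inner_scale_right a_def algebra_simps)
  also have "\<dots> = cinner H f f - a * cnj a / of_real b"
    using b by (simp add: c_def field_simps)
  also have "\<dots> = of_real ((cnorm H f)\<^sup>2 - (cmod a)\<^sup>2 / b)"
    by (simp add: inner_self[OF f] complex_norm_square[symmetric] del: of_real_power)
  finally have "0 \<le> (cnorm H f)\<^sup>2 - (cmod a)\<^sup>2 / b"
    using inner_nonneg[of "f + cscale H c g"] closed_ops f cg by simp
  then have "(cmod a)\<^sup>2 \<le> (cnorm H f * cnorm H g)\<^sup>2"
    using b by (simp add: field_simps b_def power_mult_distrib)
  then show ?thesis
    unfolding a_def by (rule power2_le_imp_le) (simp add: cnorm_def inner_nonneg f g)
qed

lemma cnorm_triangle:
  assumes f: "f \<in> vecs H" and g: "g \<in> vecs H"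
  shows "cnorm H (f + g) \<le> cnorm H f + cnorm H g"
proof (rule power2_le_imp_le)
  have "cinner H (f + g) (f + g) = cinner H f f + cinner H g g + (cinner H f g + cnj (cinner H f g))"
    using f g closed_ops inner_cnj[OF f g] by (simp add: inner_add inner_add_right algebra_simps)
  then have "(cnorm H (f + g))\<^sup>2 = (cnorm H f)\<^sup>2 + (cnorm H g)\<^sup>2 + 2 * Re (cinner H f g)"
    using inner_nonneg[of "f + g"] f g closed_ops by (simp add: cnorm_def inner_nonneg)
  also have "Re (cinner H f g) \<le> cnorm H f * cnorm H g"
    using Cauchy_Schwarz[OF f g] complex_Re_le_cmod order_trans by blast
  finally show "(cnorm H (f + g))\<^sup>2 \<le> (cnorm H f + cnorm H g)\<^sup>2"
    by (simp add: power2_sum)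
  show "0 \<le> cnorm H f + cnorm H g" by (simp add: cnorm_def inner_nonneg f g)
qed

lemma cnorm_minus_commute:
  assumes "f \<in> vecs H" "g \<in> vecs H"
  shows "cnorm H (f - g) = cnorm H (g - f)"
proof -
  have "f - g = cscale H (-1) (g - f)" by simp
  moreover have "g - f \<in> vecs H" using assms closed_ops by blast
  ultimately have "cinner H (f - g) (f - g) = cinner H (g - f) (g - f)"
    by (metis closed_ops(4) inner_scale inner_scale_right complex_cnj_minus complex_cnj_one
        mult.assoc mult_1 mult_minus1 minus_minus)
  then show ?thesis by (simp add: cnorm_def)
qed

lemma Metric_space_cdist: "Metric_space (vecs H) (cdist H)"
proof
  show "0 \<le> cdist H f g" for f g
    by (simp add: cdist_def cnorm_def closed_ops inner_nonneg)
  show "cdist H f g = cdist H g f" for f g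
    by (simp add: cdist_def cnorm_minus_commute)
  fix f g assume fg: "f \<in> vecs H" "g \<in> vecs H"
  then have d: "f - g \<in> vecs H" using closed_ops by blast
  show "cdist H f g = 0 \<longleftrightarrow> f = g"
  proof
    assume "cdist H f g = 0"
    then show "f = g"
      using fg inner_self[OF d] inner_eq_0[OF d] by (simp add: cdist_def)
  next
    assume "f = g"
    moreover have "cinner H 0 0 = 0"
      using inner_scale[of 0 0 0] closed_ops(1) by simp
    ultimately show "cdist H f g = 0" by (simp add: cdist_def cnorm_def)
  qed
  fix h assume "h \<in> vecs H"
  then show "cdist H f h \<le> cdist H f g + cdist H g h"
    using cnorm_triangle[OF d, of "g - h"] fg closed_ops by (simp add: cdist_def)
qed

end

locale complex_hilbert_space = complex_inner_product_space +
  assumes complete: "Metric_space.mcomplete (vecs H) (cdist H)"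

definition closed_span :: "('a::ab_group_add, 'm) cspace_scheme \<Rightarrow> 'a set \<Rightarrow> 'a set" where
  "closed_span H B =
     Metric_space.mtopology (vecs H) (cdist H) closure_of module.span (cscale H) B"

definition orth_compl :: "('a, 'm) cspace_scheme \<Rightarrow> 'a set \<Rightarrow> 'a set" where
  "orth_compl H M = {f \<in> vecs H. \<forall>g\<in>M. cinner H f g = 0}"

definition linear_isometry ::
  "('a::ab_group_add, 'm) cspace_scheme \<Rightarrow> ('b::ab_group_add, 'n) cspace_scheme \<Rightarrow> ('a \<Rightarrow> 'b) \<Rightarrow> bool"
where
  "linear_isometry H K A \<longleftrightarrow>
     A \<in> vecs H \<rightarrow> vecs K \<and>
     (\<forall>f\<in>vecs H. \<forall>g\<in>vecs H. A (f + g) = A f + A g) \<and>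
     (\<forall>c. \<forall>f\<in>vecs H. A (cscale H c f) = cscale K c (A f)) \<and>
     (\<forall>f\<in>vecs H. cnorm K (A f) = cnorm H f)"


section \<open>Operator ranges\<close>

definition kernel_on :: "('a, 'm) cspace_scheme \<Rightarrow> ('a \<Rightarrow> 'b::zero) \<Rightarrow> 'a set" where
  "kernel_on H A = {f \<in> vecs H. A f = 0}"

text \<open>
  If \<open>A\<close> is linear with closed kernel then \<open>H\<close> is the direct sum of \<open>ker A\<close> and its
  orthogonal complement, so \<open>A\<close> restricts to a bijection from that complement onto
  \<open>A ` vecs H\<close>; the inner product is transported along this bijection. The argument
  \<open>s\<close> is the scalar multiplication of the codomain of \<open>A\<close>.
\<close>

definition operator_range ::
  "('a, 'm) cspace_scheme \<Rightarrow> (complex \<Rightarrow> 'b \<Rightarrow> 'b) \<Rightarrow> ('a \<Rightarrow> 'b::ab_group_add) \<Rightarrow> 'b cspace" where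
  "operator_range H s A =
     (let lift = inv_into (orth_compl H (kernel_on H A)) A
      in \<lparr>vecs = A ` vecs H, cscale = s, cinner = (\<lambda>u v. cinner H (lift u) (lift v))\<rparr>)"

lemma (in complex_inner_product_space) cinner_operator_range:
  assumes add: "\<And>f g. \<lbrakk>f \<in> vecs H; g \<in> vecs H\<rbrakk> \<Longrightarrow> A (f + g) = A f + A g"
    and f: "f \<in> orth_compl H (kernel_on H A)" and g: "g \<in> orth_compl H (kernel_on H A)"
  shows "cinner (operator_range H s A) (A f) (A g) = cinner H f g"
proof -
  have "inj_on A (orth_compl H (kernel_on H A))"
  proof (rule inj_onI)
    fix x y assume x: "x \<in> orth_compl H (kernel_on H A)" and y: "y \<in> orth_compl H (kernel_on H A)"
      and eq: "A x = A y"
    have v: "x \<in> vecs H" "y \<in> vecs H" using x y by (auto simp: orth_compl_def)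
    then have d: "x - y \<in> vecs H" using closed_ops by blast
    then have "A (x - y) = 0" using add[OF d v(2)] eq by simp
    then have k: "x - y \<in> kernel_on H A" using d by (simp add: kernel_on_def)
    then have "cinner H (x - y) (x - y) = 0"
      using x y inner_diff[OF v d] by (simp add: orth_compl_def)
    then show "x = y" using inner_eq_0[OF d] by simp
  qed
  then show ?thesis using f g by (simp add: operator_range_def Let_def)
qed


section \<open>Spaces of functions and the integral transform\<close>

text \<open>
  A function on a set \<open>X\<close> is represented by its extension by zero to the whole type. The
  functions of this form are a subspace of the type of all functions, with pointwise operations.
\<close>

definition on_set :: "'x set \<Rightarrow> ('x \<Rightarrow> complex) \<Rightarrow> 'x \<Rightarrow> complex" where
  "on_set X g = (\<lambda>x. if x \<in> X then g x else 0)"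

definition functions_on :: "'x set \<Rightarrow> ('x \<Rightarrow> complex) set" where
  "functions_on X = range (on_set X)"

definition fun_scale :: "complex \<Rightarrow> ('x \<Rightarrow> complex) \<Rightarrow> 'x \<Rightarrow> complex" where
  "fun_scale c g = (\<lambda>x. c * g x)"

definition rkhs :: "'t set \<Rightarrow> ('t \<Rightarrow> complex) cspace \<Rightarrow> bool" where
  "rkhs T W \<longleftrightarrow>
     complex_hilbert_space W \<and> vecs W \<subseteq> functions_on T \<and> cscale W = fun_scale \<and>
     (\<forall>t\<in>T. \<exists>C. \<forall>f\<in>vecs W. cmod (f t) \<le> C * cnorm W f)"

definition hat :: "'e set \<Rightarrow> ('h, 'm) cspace_scheme \<Rightarrow> ('e \<Rightarrow> 'h) \<Rightarrow> 'h \<Rightarrow> 'e \<Rightarrow> complex" where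
  "hat E H \<phi> f = on_set E (\<lambda>x. cinner H f (\<phi> x))"

definition integral_transform ::
  "'e set \<Rightarrow> ('h, 'm) cspace_scheme \<Rightarrow> ('e \<Rightarrow> 'h) \<Rightarrow> ('e \<Rightarrow> complex) cspace" where
  "integral_transform E H \<phi> = operator_range H fun_scale (hat E H \<phi>)"

end

theory Submission
  imports Defs
begin

text \<open>
  For fixed \<open>t\<close>, the functional \<open>f \<mapsto> (S f)(t)\<close> is bounded on \<open>H\<close>: point evaluation is bounded
  on \<open>W\<close> and \<open>S\<close> is isometric. Let \<open>V\<close> be the orthogonal complement of the kernel of the integral
  transform. It is a closed subspace, so the Riesz representation theorem, applied on \<open>V\<close> rather
  than on \<open>H\<close>, yields \<open>p \<in> V\<close> with \<open>(S f)(t) = \<langle>f, p\<rangle>\<close> for all \<open>f \<in> V\<close>. The kernel consists of the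
  vectors orthogonal to \<open>\<phi>(E)\<close>; hence \<open>V\<close> contains \<open>\<phi>(E)\<close> and its closed linear span.

  Two consequences finish the argument. Taking \<open>f = \<phi>(x)\<close> and conjugating shows that the integral
  transform of \<open>p\<close> is the function \<open>x \<mapsto> cnj ((S\<phi>)(t, x))\<close>. For \<open>f\<close> in the closed span, both
  \<open>f\<close> and \<open>p\<close> lie in \<open>V\<close>, where the transform preserves inner products, so \<open>\<langle>f, p\<rangle>\<close> equals the
  inner product of the two transforms. Representing the functional on \<open>V\<close> places \<open>p\<close> in \<open>V\<close> at
  once; a representer in \<open>H\<close> would first have to be projected there.

  The Riesz theorem is proved by the variational method: its representer minimizes
  \<open>f \<mapsto> \<parallel>f\<parallel>\<^sup>2 - 2 Re l(f)\<close>. A vector that almost minimizes this energy almost represents \<open>l\<close>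
  (\<open>almost_minimizer_almost_represents\<close>), and this one estimate gives both that minimizing
  sequences are Cauchy and that their limits represent \<open>l\<close>.
\<close>

section \<open>Limits of inner products\<close>

context complex_inner_product_space
begin

lemma cnorm_nonneg: "f \<in> vecs H \<Longrightarrow> 0 \<le> cnorm H f"
  by (simp add: cnorm_def inner_nonneg)

lemma inner_diff_right:
  assumes "f \<in> vecs H" "g \<in> vecs H" "h \<in> vecs H"
  shows "cinner H f (g - h) = cinner H f g - cinner H f h"
  using inner_add_right[of f "g - h" h] assms closed_ops(3)[of g h] by simp

lemma tendsto_inner_right:
  assumes lim: "limitin (Metric_space.mtopology (vecs H) (cdist H)) F p sequentially"
    and F: "\<And>n. F n \<in> vecs H" and h: "h \<in> vecs H"
  shows "(\<lambda>n. cinner H h (F n)) \<longlonglongrightarrow> cinner H h p"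
proof -
  interpret M: Metric_space "vecs H" "cdist H" by (rule Metric_space_cdist)
  have p: "p \<in> vecs H" and dist0: "(\<lambda>n. cdist H (F n) p) \<longlonglongrightarrow> 0"
    using lim unfolding M.limitin_metric_dist_null by auto
  have "(\<lambda>n. cinner H h (F n) - cinner H h p) \<longlonglongrightarrow> 0"
  proof (rule Lim_null_comparison)
    show "\<forall>\<^sub>F n in sequentially.
        cmod (cinner H h (F n) - cinner H h p) \<le> cnorm H h * cdist H (F n) p"
    proof (rule always_eventually, rule allI)
      fix n
      show "cmod (cinner H h (F n) - cinner H h p) \<le> cnorm H h * cdist H (F n) p"
        using Cauchy_Schwarz[OF h closed_ops(3)[OF F[of n] p]]
        by (simp add: inner_diff_right F p h cdist_def)
    qed
    show "(\<lambda>n. cnorm H h * cdist H (F n) p) \<longlonglongrightarrow> 0"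
      using tendsto_mult_left[OF dist0, of "cnorm H h"] by simp
  qed
  then show ?thesis using Lim_null by blast
qed

section \<open>Orthogonal complements\<close>

lemma subspace_orth_compl:
  assumes "M \<subseteq> vecs H"
  shows "subspace (orth_compl H M)"
proof -
  have Mv: "g \<in> vecs H" if "g \<in> M" for g using that assms by blast
  have "cinner H 0 g = 0" if "g \<in> M" for g
    using inner_scale[of 0 g 0] closed_ops(1) Mv[OF that] by simp
  then show ?thesis
    by (intro subspaceI) (simp_all add: orth_compl_def closed_ops inner_add inner_scale Mv)
qed

lemma closedin_orth_compl:
  assumes M: "M \<subseteq> vecs H"
  shows "closedin (Metric_space.mtopology (vecs H) (cdist H)) (orth_compl H M)"
proof -
  interpret M: Metric_space "vecs H" "cdist H" by (rule Metric_space_cdist)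
  have "p \<in> orth_compl H M"
    if F: "range F \<subseteq> orth_compl H M" and lim: "limitin M.mtopology F p sequentially" for F p
  proof -
    have Fv: "F n \<in> vecs H" and F0: "\<And>g. g \<in> M \<Longrightarrow> cinner H (F n) g = 0" for n
      using F by (auto simp: orth_compl_def)
    have p: "p \<in> vecs H" using lim M.limitin_mspace by blast
    have "cinner H p g = 0" if g: "g \<in> M" for g
    proof -
      have gv: "g \<in> vecs H" using g M by blast
      have "cinner H g (F n) = 0" for n
        using inner_cnj[OF Fv gv] F0[OF g] by simp
      then have "cinner H g p = 0"
        using tendsto_inner_right[OF lim Fv gv] by (simp add: LIMSEQ_const_iff)
      then show ?thesis using inner_cnj[OF gv p] by simp
    qed
    then show ?thesis using p by (simp add: orth_compl_def)
  qed
  moreover have "orth_compl H M \<subseteq> vecs H" by (auto simp: orth_compl_def)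
  ultimately show ?thesis
    using M.metric_closedin_iff_sequentially_closed by blast
qed

lemma closed_span_subset_orth_compl:
  assumes "M \<subseteq> vecs H" "B \<subseteq> orth_compl H M"
  shows "closed_span H B \<subseteq> orth_compl H M"
  unfolding closed_span_def
  by (intro closure_of_minimal closedin_orth_compl span_minimal subspace_orth_compl assms)

section \<open>The Riesz representation theorem\<close>

text \<open>
  Moving from \<open>f\<close> by \<open>c h\<close> changes the energy \<open>\<parallel>f\<parallel>\<^sup>2 - 2 Re l(f)\<close> by
  \<open>\<bar>c\<bar>\<^sup>2 \<parallel>h\<parallel>\<^sup>2 + 2 Re (c d)\<close>, where \<open>d\<close> is the defect \<open>\<langle>h, f\<rangle> - l(h)\<close>. The best choice of \<open>c\<close> lowers
  the energy by \<open>\<bar>d\<bar>\<^sup>2 / \<parallel>h\<parallel>\<^sup>2\<close>, which cannot exceed the gap between \<open>f\<close> and the lower bound \<open>m\<close>.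
\<close>

lemma almost_minimizer_almost_represents:
  fixes l :: "'a \<Rightarrow> complex"
  assumes V: "subspace V" "V \<subseteq> vecs H"
    and ladd: "\<And>f g. \<lbrakk>f \<in> V; g \<in> V\<rbrakk> \<Longrightarrow> l (f + g) = l f + l g"
    and lscale: "\<And>c f. f \<in> V \<Longrightarrow> l (cscale H c f) = c * l f"
    and lower: "\<And>g. g \<in> V \<Longrightarrow> m \<le> (cnorm H g)\<^sup>2 - 2 * Re (l g)"
    and near: "(cnorm H f)\<^sup>2 - 2 * Re (l f) \<le> m + e\<^sup>2"
    and e: "0 \<le> e" and f: "f \<in> V" and h: "h \<in> V"
  shows "cmod (cinner H h f - l h) \<le> e * cnorm H h"
proof (cases "cnorm H h = 0")
  case True
  have "h \<in> vecs H" using h V by blast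
  then have "h = 0" using True inner_self inner_eq_0 by simp
  moreover have "l 0 = 0" using lscale[OF f, of 0] by simp
  moreover have "cinner H 0 f = 0"
    using inner_scale[of f f 0] f V by auto
  ultimately show ?thesis using True by simp
next
  case False
  have fv: "f \<in> vecs H" and hv: "h \<in> vecs H" using f h V by auto
  define b where "b = (cnorm H h)\<^sup>2"
  have b: "0 < b" using False by (simp add: b_def)
  define d where "d = cinner H h f - l h"
  \<comment> \<open>the minimizer of \<open>\<bar>c\<bar>\<^sup>2 b + 2 Re (c d)\<close>\<close>
  define c where "c = - (cnj d / of_real b)"
  have ch: "cscale H c h \<in> V" using V h subspace_scale by blast
  then have chv: "cscale H c h \<in> vecs H" using V by blast
  have fchV: "f + cscale H c h \<in> V" using V f ch subspace_add by blast
  then have fch: "f + cscale H c h \<in> vecs H" using V by blast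
  have "cinner H (f + cscale H c h) (f + cscale H c h)
      = cinner H f f + c * cnj c * of_real b + (c * cinner H h f + cnj (c * cinner H h f))"
    using fv hv chv closed_ops inner_cnj[OF hv fv] inner_self[OF hv]
    by (simp add: inner_add inner_add_right inner_scale inner_scale_right b_def algebra_simps)
  then have "Re (cinner H (f + cscale H c h) (f + cscale H c h))
      = Re (cinner H f f) + (cmod c)\<^sup>2 * b + 2 * Re (c * cinner H h f)"
    by (simp add: complex_norm_square[symmetric] del: of_real_power)
  then have "(cnorm H (f + cscale H c h))\<^sup>2
      = (cnorm H f)\<^sup>2 + (cmod c)\<^sup>2 * b + 2 * Re (c * cinner H h f)"
    using inner_nonneg[OF fch] inner_nonneg[OF fv] by (simp add: cnorm_def)
  moreover have "Re (l (f + cscale H c h)) = Re (l f) + Re (c * l h)"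
    using ladd[OF f ch] lscale[OF h] by simp
  moreover have "m \<le> (cnorm H (f + cscale H c h))\<^sup>2 - 2 * Re (l (f + cscale H c h))"
    by (rule lower[OF fchV])
  moreover have "Re (c * d) = Re (c * cinner H h f) - Re (c * l h)"
    by (simp add: d_def algebra_simps)
  ultimately have "0 \<le> e\<^sup>2 + (cmod c)\<^sup>2 * b + 2 * Re (c * d)"
    using near by linarith
  moreover have "c * d = of_real (- ((cmod d)\<^sup>2 / b))"
    using complex_norm_square[of d] by (simp add: c_def mult.commute)
  then have "Re (c * d) = - ((cmod d)\<^sup>2 / b)" by (metis Re_complex_of_real)
  moreover have "(cmod c)\<^sup>2 * b = (cmod d)\<^sup>2 / b"
    using b by (simp add: c_def norm_divide power_divide power2_eq_square)
  ultimately have "(cmod d)\<^sup>2 / b \<le> e\<^sup>2" by linarith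
  then have "(cmod d)\<^sup>2 \<le> (e * cnorm H h)\<^sup>2"
    using b by (simp add: field_simps b_def)
  then show ?thesis
    unfolding d_def by (rule power2_le_imp_le) (simp add: e cnorm_nonneg[OF hv])
qed

end

text \<open>
  The terms of a minimizing sequence represent \<open>l\<close> up to errors that tend to zero. Testing the
  difference of two terms against itself bounds their distance by the sum of their errors, so the
  sequence is Cauchy; its limit represents \<open>l\<close> exactly.
\<close>

theorem (in complex_hilbert_space) riesz_closed_subspace:
  fixes l :: "'a \<Rightarrow> complex"
  assumes V: "subspace V" "V \<subseteq> vecs H"
    and closed: "closedin (Metric_space.mtopology (vecs H) (cdist H)) V"
    and ladd: "\<And>f g. \<lbrakk>f \<in> V; g \<in> V\<rbrakk> \<Longrightarrow> l (f + g) = l f + l g"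
    and lscale: "\<And>c f. f \<in> V \<Longrightarrow> l (cscale H c f) = c * l f"
    and bounded: "\<And>f. f \<in> V \<Longrightarrow> cmod (l f) \<le> C * cnorm H f"
  obtains p where "p \<in> V" "\<And>f. f \<in> V \<Longrightarrow> l f = cinner H f p"
proof -
  interpret M: Metric_space "vecs H" "cdist H" by (rule Metric_space_cdist)
  define J where "J f = (cnorm H f)\<^sup>2 - 2 * Re (l f)" for f
  \<comment> \<open>completing the square in \<open>\<parallel>f\<parallel>\<^sup>2 - 2 C \<parallel>f\<parallel>\<close>\<close>
  have Jlow: "- (C\<^sup>2) \<le> J f" if "f \<in> V" for f
  proof -
    have "Re (l f) \<le> C * cnorm H f"
      using bounded[OF that] complex_Re_le_cmod order_trans by blast
    moreover have "0 \<le> (cnorm H f - C)\<^sup>2" by simp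
    ultimately show ?thesis
      unfolding J_def power2_diff mult.assoc mult.commute[of _ C] by linarith
  qed
  have bdd: "bdd_below (J ` V)" by (rule bdd_belowI2[OF Jlow])
  define m where "m = Inf (J ` V)"
  have lower: "m \<le> J g" if "g \<in> V" for g
    unfolding m_def by (rule cINF_lower[OF bdd that])
  define e where "e n = inverse (real (Suc n))" for n
  have epos: "0 < e n" for n by (simp add: e_def)
  have "J ` V \<noteq> {}" using V subspace_0 by blast
  \<comment> \<open>the energy gap is squared because the representation error is its square root\<close>
  then have "\<exists>f\<in>V. J f < m + (e n)\<^sup>2" for n
    using cINF_less_iff[OF _ bdd, of "m + (e n)\<^sup>2"] epos[of n] by (auto simp: m_def)
  then obtain F where FV: "\<And>n. F n \<in> V" and FJ: "\<And>n. J (F n) < m + (e n)\<^sup>2" by metis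
  have Fv: "F n \<in> vecs H" for n using FV V by blast
  have near: "cmod (cinner H h (F n) - l h) \<le> e n * cnorm H h" if "h \<in> V" for h n
    by (rule almost_minimizer_almost_represents[OF V ladd lscale _ _ _ FV that, where m = m])
       (use lower FJ[of n] epos[of n] in \<open>auto simp: J_def less_imp_le\<close>)
  have Fdist: "cdist H (F i) (F j) \<le> e i + e j" for i j
  proof -
    define h where "h = F i - F j"
    have h: "h \<in> V" unfolding h_def using V FV subspace_diff by blast
    then have hv: "h \<in> vecs H" using V by blast
    have "cinner H h h = (cinner H h (F i) - l h) - (cinner H h (F j) - l h)"
      using inner_diff_right[OF hv Fv Fv, of i j] by (simp add: h_def)
    then have "cmod (cinner H h h) \<le> e i * cnorm H h + e j * cnorm H h"
      using near[OF h, of i] near[OF h, of j]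
        norm_triangle_ineq4[of "cinner H h (F i) - l h" "cinner H h (F j) - l h"] by simp
    then have "cnorm H h * cnorm H h \<le> (e i + e j) * cnorm H h"
      using inner_self[OF hv] by (simp add: norm_power power2_eq_square distrib_right norm_mult)
    then have "cnorm H h \<le> e i + e j"
      using cnorm_nonneg[OF hv] epos[of i] epos[of j] by (cases "cnorm H h = 0") auto
    then show ?thesis by (simp add: cdist_def Fv h_def)
  qed
  have elim: "e \<longlonglongrightarrow> 0" unfolding e_def by (rule LIMSEQ_inverse_real_of_nat)
  have "M.MCauchy F"
    unfolding M.MCauchy_def
  proof (intro conjI allI impI)
    show "range F \<subseteq> vecs H" using Fv by blast
    fix r :: real assume "0 < r"
    then have "\<forall>\<^sub>F n in sequentially. e n < r / 2"
      using order_tendstoD(2)[OF elim, of "r / 2"] by simp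
    then obtain N where N: "\<And>n. N \<le> n \<Longrightarrow> e n < r / 2"
      by (auto simp: eventually_sequentially)
    show "\<exists>N. \<forall>n n'. N \<le> n \<longrightarrow> N \<le> n' \<longrightarrow> cdist H (F n) (F n') < r"
    proof (intro exI[of _ N] allI impI)
      fix i j assume "N \<le> i" "N \<le> j"
      then show "cdist H (F i) (F j) < r"
        using N[of i] N[of j] Fdist[of i j] by linarith
    qed
  qed
  then obtain p where lim: "limitin M.mtopology F p sequentially"
    using complete M.mcomplete_def by blast
  have "p \<in> V"
    using closed lim FV M.metric_closedin_iff_sequentially_closed by blast
  moreover have "l h = cinner H h p" if h: "h \<in> V" for h
  proof -
    have hv: "h \<in> vecs H" using h V by blast
    have "(\<lambda>n. cinner H h (F n) - l h) \<longlonglongrightarrow> 0"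
    proof (rule Lim_null_comparison)
      show "\<forall>\<^sub>F n in sequentially. cmod (cinner H h (F n) - l h) \<le> e n * cnorm H h"
        using near[OF h] by simp
      show "(\<lambda>n. e n * cnorm H h) \<longlonglongrightarrow> 0"
        using tendsto_mult_right[OF elim, of "cnorm H h"] by simp
    qed
    then have "(\<lambda>n. cinner H h (F n)) \<longlonglongrightarrow> l h" using Lim_null by blast
    then show ?thesis
      using tendsto_inner_right[OF lim Fv hv] LIMSEQ_unique by blast
  qed
  ultimately show thesis using that by blast
qed

section \<open>Integral transforms and transformation sequences\<close>

lemma (in complex_inner_product_space) hat_add:
  assumes "\<phi> \<in> E \<rightarrow> vecs H" "f \<in> vecs H" "g \<in> vecs H"
  shows "hat E H \<phi> (f + g) = hat E H \<phi> f + hat E H \<phi> g"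
  using assms by (auto simp: hat_def on_set_def fun_eq_iff inner_add Pi_iff)

lemma (in complex_inner_product_space) image_subset_orth_compl_kernel_hat:
  assumes \<phi>: "\<phi> \<in> E \<rightarrow> vecs H"
  shows "\<phi> ` E \<subseteq> orth_compl H (kernel_on H (hat E H \<phi>))"
proof -
  have "cinner H (\<phi> x) g = 0" if x: "x \<in> E" and g: "g \<in> kernel_on H (hat E H \<phi>)" for x g
  proof -
    have gv: "g \<in> vecs H" and "hat E H \<phi> g x = 0" using g by (auto simp: kernel_on_def)
    then have "cinner H g (\<phi> x) = 0" using x by (simp add: hat_def on_set_def)
    then show ?thesis using inner_cnj[OF gv, of "\<phi> x"] x \<phi> by auto
  qed
  then show ?thesis using \<phi> by (auto simp: orth_compl_def)
qed

theorem theorem3p2: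
  fixes E :: "'e set" and T :: "'t set"
    and H :: "('h::ab_group_add) cspace" and W :: "('t \<Rightarrow> complex) cspace"
    and \<phi> :: "'e \<Rightarrow> 'h" and S :: "'h \<Rightarrow> 't \<Rightarrow> complex"
  assumes "complex_hilbert_space H"
    and "\<phi> \<in> E \<rightarrow> vecs H"
    and "rkhs T W"
    and "linear_isometry H W S"
  shows "\<forall>f \<in> closed_span H (\<phi> ` E). \<forall>t \<in> T.
    on_set E (\<lambda>x. cnj (S (\<phi> x) t)) \<in> vecs (integral_transform E H \<phi>) \<and>
    S f t = cinner (integral_transform E H \<phi>)
              (hat E H \<phi> f) (on_set E (\<lambda>x. cnj (S (\<phi> x) t)))"
proof (intro ballI)
  fix f t assume f: "f \<in> closed_span H (\<phi> ` E)" and t: "t \<in> T"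
  interpret complex_hilbert_space H by fact
  note \<phi> = assms(2)
  define N where "N = kernel_on H (hat E H \<phi>)"
  define V where "V = orth_compl H N"
  have N: "N \<subseteq> vecs H" by (auto simp: N_def kernel_on_def)
  have Vv: "V \<subseteq> vecs H" by (auto simp: V_def orth_compl_def)
  have \<phi>V: "\<phi> ` E \<subseteq> V"
    unfolding V_def N_def by (rule image_subset_orth_compl_kernel_hat[OF \<phi>])
  then have fV: "f \<in> V"
    using closed_span_subset_orth_compl[OF N] f unfolding V_def by blast
  obtain C where C: "\<And>g. g \<in> vecs W \<Longrightarrow> cmod (g t) \<le> C * cnorm W g"
    and W: "cscale W = fun_scale"
    using assms(3) t unfolding rkhs_def by blast
  have S: "\<And>g. g \<in> vecs H \<Longrightarrow> S g \<in> vecs W"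
      "\<And>g h. \<lbrakk>g \<in> vecs H; h \<in> vecs H\<rbrakk> \<Longrightarrow> S (g + h) = S g + S h"
      "\<And>c g. g \<in> vecs H \<Longrightarrow> S (cscale H c g) = fun_scale c (S g)"
      "\<And>g. g \<in> vecs H \<Longrightarrow> cnorm W (S g) = cnorm H g"
    using assms(4) W by (auto simp: linear_isometry_def)
  obtain p where p: "p \<in> V" and rep: "\<And>g. g \<in> V \<Longrightarrow> S g t = cinner H g p"
  proof (rule riesz_closed_subspace[of V "\<lambda>g. S g t" C])
    show "subspace V" unfolding V_def by (rule subspace_orth_compl[OF N])
    show "closedin (Metric_space.mtopology (vecs H) (cdist H)) V"
      unfolding V_def by (rule closedin_orth_compl[OF N])
    show "cmod (S g t) \<le> C * cnorm H g" if "g \<in> V" for g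
      using C[OF S(1)[of g]] S(4)[of g] that Vv by auto
  qed (use Vv S in \<open>auto simp: fun_scale_def subset_eq\<close>)
  have pv: "p \<in> vecs H" using p Vv by blast
  have hat_p: "hat E H \<phi> p = on_set E (\<lambda>x. cnj (S (\<phi> x) t))"
  proof
    fix x
    show "hat E H \<phi> p x = on_set E (\<lambda>x. cnj (S (\<phi> x) t)) x"
    proof (cases "x \<in> E")
      case True
      then have "\<phi> x \<in> V" using \<phi>V by blast
      moreover from this have "\<phi> x \<in> vecs H" using Vv by blast
      ultimately show ?thesis
        using rep[of "\<phi> x"] inner_cnj[OF _ pv, of "\<phi> x"] True
        by (simp add: hat_def on_set_def)
    qed (simp add: hat_def on_set_def)
  qed
  have "hat E H \<phi> p \<in> vecs (integral_transform E H \<phi>)"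
    using pv by (simp add: integral_transform_def operator_range_def Let_def)
  moreover have "cinner (integral_transform E H \<phi>) (hat E H \<phi> f) (hat E H \<phi> p) = cinner H f p"
    unfolding integral_transform_def
    by (rule cinner_operator_range[where A = "hat E H \<phi>" and f = f and g = p])
       (use fV p hat_add[OF \<phi>] in \<open>auto simp: V_def N_def\<close>)
  ultimately show "on_set E (\<lambda>x. cnj (S (\<phi> x) t)) \<in> vecs (integral_transform E H \<phi>) \<and>
    S f t = cinner (integral_transform E H \<phi>)
              (hat E H \<phi> f) (on_set E (\<lambda>x. cnj (S (\<phi> x) t)))"
    using rep[OF fV] hat_p by simp
qed

end
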